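(* Let $a$ and $b$ be positive coprime integers with $b < a$. Let $\alpha$ be an integer with $0 < \alpha < a$ and $\alpha \equiv a \pmod 2$, and let $\beta = 2 \left\lfloor \frac{b(\alpha + a)}{2a} \right\rfloor - b$. Then $$N_0\left(a,b;\frac{b\alpha + a\beta}{2}\right) = \frac{(\alpha+1)(\beta+1)}{2}.$$
   Context: $\lfloor x \rfloor$ denotes the greatest integer less than or equal to $x$. For positive coprime integers $a$ and $b$ and an integer $k$ with $0 \leq k < (a-1)(b-1)$, $N_0(a,b;k)$ denotes the number of nonnegative integers $n \leq k$ that can be expressed in the form $n = ax+by$ for nonnegative integers $x$ and $y$. For $k<0$, $N_0(a,b;k)$ is defined to be $0$. *)

theory Defs
  imports Complex_Main "HOL-Number_Theory.Cong"
begin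

text \<open>
  The conventional domain of \<open>N\<^sub>0(a,b;k)\<close> is \<open>k < (a - 1) (b - 1)\<close>. Above this bound the
  same counting formula is used here. Lemmas \<open>N0_argument_exact\<close> and
  \<open>N0_argument_in_domain\<close> show that \<open>(b * \<alpha> + a * \<beta>) div 2\<close> is an exact quotient
  and lies in the conventional domain.
\<close>

definition N0 :: "int \<Rightarrow> int \<Rightarrow> int \<Rightarrow> nat" where
  "N0 a b k =
     (if k < 0 then 0
      else card {n::int. 0 \<le> n \<and> n \<le> k \<and> (\<exists>x y::int. 0 \<le> x \<and> 0 \<le> y \<and> n = a * x + b * y)})"

lemma floor_eq_div:
  fixes a b \<alpha> :: int
  shows "\<lfloor>real_of_int (b * (\<alpha> + a)) / real_of_int (2 * a)\<rfloor> = b * (\<alpha> + a) div (2 * a)"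
  by (rule floor_divide_of_int_eq)

lemma N0_argument_exact:
  fixes a b \<alpha> \<beta> :: int
  assumes "[\<alpha> = a] (mod 2)"
    and "\<beta> = 2 * \<lfloor>real_of_int (b * (\<alpha> + a)) / real_of_int (2 * a)\<rfloor> - b"
  shows "2 dvd b * \<alpha> + a * \<beta>"
proof -
  have "2 dvd \<alpha> - a"
    using assms(1) by (simp add: cong_iff_dvd_diff)
  then obtain c where c: "\<alpha> = a + 2 * c"
    by (metis dvdE diff_add_cancel add.commute)
  show ?thesis
    unfolding assms(2) c by (simp add: algebra_simps)
qed

lemma N0_argument_in_domain:
  fixes a b \<alpha> \<beta> :: int
  assumes "0 < a" "0 < b" "\<alpha> < a"
    and "[\<alpha> = a] (mod 2)"
    and "\<beta> = 2 * \<lfloor>real_of_int (b * (\<alpha> + a)) / real_of_int (2 * a)\<rfloor> - b"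
  shows "(b * \<alpha> + a * \<beta>) div 2 < (a - 1) * (b - 1)"
proof -
  define q where "q = b * (\<alpha> + a) div (2 * a)"
  have \<beta>: "\<beta> = 2 * q - b"
    using assms(5) by (simp only: q_def floor_eq_div)
  have "2 dvd \<alpha> - a"
    using assms(4) by (simp add: cong_iff_dvd_diff)
  then have \<alpha>: "\<alpha> \<le> a - 2"
    using assms(3) by presburger
  have "b * (\<alpha> + a) < b * (2 * a)"
    using assms(2,3) by (intro mult_strict_left_mono) auto
  moreover have "q * (2 * a) \<le> b * (\<alpha> + a)"
    unfolding q_def
    using assms(1) div_mult_mod_eq[of "b * (\<alpha> + a)" "2 * a"]
      pos_mod_sign[of "2 * a" "b * (\<alpha> + a)"]
    by linarith
  ultimately have "q * (2 * a) < b * (2 * a)"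
    by linarith
  then have "q < b"
    using assms(1) by simp
  then have "a * \<beta> \<le> a * (b - 2)"
    using assms(1) \<beta> by (intro mult_left_mono) auto
  moreover have "b * \<alpha> \<le> b * (a - 2)"
    using assms(2) \<alpha> by (intro mult_left_mono) auto
  ultimately have "b * \<alpha> + a * \<beta> < 2 * ((a - 1) * (b - 1))"
    by (simp add: algebra_simps)
  then show ?thesis
    by linarith
qed

end

theory Submission imports Defs begin

text \<open>
  Write \<open>k = (b * \<alpha> + a * \<beta>) div 2\<close> and consider the lattice rectangle \<open>R = {0..\<beta>} \<times> {0..\<alpha>}\<close>.
  The line \<open>a * x + b * y = k\<close> passes through the centre \<open>(\<beta>/2, \<alpha>/2)\<close> of \<open>R\<close>, so the point
  reflection in the centre exchanges the two sides of the line within \<open>R\<close>. If the line carries no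
  lattice point of \<open>R\<close>, exactly half of the \<open>(\<alpha> + 1) * (\<beta> + 1)\<close> points of \<open>R\<close> lie below it
  (lemma \<open>card_rectangle_below_central_line\<close>).

  It remains to identify these points with the numbers counted by \<open>N0 a b k\<close>. Put
  \<open>p = (\<alpha> + a) / 2\<close>, \<open>q = b * p div a\<close> and \<open>r = b * p mod a\<close>, so that \<open>\<alpha> = 2 * p - a\<close> and
  \<open>\<beta> = 2 * q - b\<close>. Then \<open>k = a * \<beta> + r = b * \<alpha> - r\<close> with \<open>0 \<le> r < a\<close>, and therefore every
  nonnegative \<open>(x, y)\<close> with \<open>a * x + b * y \<le> k\<close> satisfies \<open>x \<le> \<beta>\<close> and \<open>y \<le> \<alpha>\<close>: the choice of \<open>\<beta>\<close>
  through the floor makes the whole triangle fit into the rectangle. Since \<open>\<alpha> < a\<close>,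
  coprimality makes \<open>a * x + b * y\<close> injective on \<open>R\<close> (lemma \<open>inj_on_linear_form\<close>).
  Finally \<open>k = b * p + a * (q - b)\<close>, so a point of \<open>R\<close> on the line would have
  \<open>y\<close> congruent to \<open>p\<close> modulo \<open>a\<close>, which \<open>0 \<le> y \<le> \<alpha> < p < a\<close> excludes.
\<close>

lemma coprime_linear_eq_imp_eq_snd:
  fixes a b x x' y y' :: int
  assumes "coprime a b" "a * x + b * y = a * x' + b * y'" "\<bar>y - y'\<bar> < a"
  shows "y = y'"
proof -
  have "b * (y - y') = a * (x' - x)"
    using assms(2) by (simp add: algebra_simps)
  then have "a dvd b * (y - y')"
    by simp
  then have "a dvd y - y'"
    using assms(1) coprime_dvd_mult_right_iff by blast
  then show ?thesis
    using assms(3) zdvd_not_zless[of "\<bar>y - y'\<bar>" a] by fastforce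
qed

lemma inj_on_linear_form:
  fixes a b m n :: int
  assumes "0 < a" "coprime a b" "n < a"
  shows "inj_on (\<lambda>(x, y). a * x + b * y) ({0..m} \<times> {0..n})"
proof (rule inj_onI, clarsimp)
  fix x y x' y' :: int
  assume *: "a * x + b * y = a * x' + b * y'" "0 \<le> y" "y \<le> n" "0 \<le> y'" "y' \<le> n"
  then have "\<bar>y - y'\<bar> < a"
    using assms(3) by linarith
  with assms(2) * have "y = y'"
    using coprime_linear_eq_imp_eq_snd by blast
  with * assms(1) show "x = x' \<and> y = y'"
    by simp
qed

text \<open>
  The reflection \<open>(x, y) \<mapsto> (m - x, n - y)\<close> turns the value \<open>v = a * x + b * y\<close> into \<open>2 * k - v\<close>,
  so it is a bijection between the points below the central line and those above it.
\<close>

lemma card_rectangle_below_central_line: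
  fixes a b m n k :: int
  assumes "2 * k = a * m + b * n"
    and off_line: "\<And>x y. \<lbrakk>x \<in> {0..m}; y \<in> {0..n}\<rbrakk> \<Longrightarrow> a * x + b * y \<noteq> k"
  shows "2 * card {(x, y). x \<in> {0..m} \<and> y \<in> {0..n} \<and> a * x + b * y \<le> k}
    = card ({0..m} \<times> {0..n})"
proof -
  define below where "below = {(x, y). x \<in> {0..m} \<and> y \<in> {0..n} \<and> a * x + b * y \<le> k}"
  define above where "above = {(x, y). x \<in> {0..m} \<and> y \<in> {0..n} \<and> k < a * x + b * y}"
  have reflect: "a * (m - x) + b * (n - y) = 2 * k - (a * x + b * y)" for x y
    using assms(1) by (simp add: algebra_simps)
  have "bij_betw (\<lambda>(x, y). (m - x, n - y)) below above"
    by (rule bij_betw_byWitness[where f' = "\<lambda>(x, y). (m - x, n - y)"])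
      (use off_line in \<open>fastforce simp: below_def above_def reflect\<close>)+
  then have same: "card below = card above"
    by (rule bij_betw_same_card)
  have un: "{0..m} \<times> {0..n} = below \<union> above"
    unfolding below_def above_def by auto
  then have "finite below" "finite above"
    by (metis finite_Un finite_SigmaI finite_atLeastAtMost_int)+
  moreover have "below \<inter> above = {}"
    unfolding below_def above_def by auto
  ultimately show ?thesis
    using same un card_Un_disjoint[of below above] below_def by simp
qed

theorem theorem8:
  fixes a b \<alpha> \<beta> :: int
  assumes "0 < a" and "0 < b"
    and "coprime a b"
    and "b < a"
    and "0 < \<alpha>" and "\<alpha> < a"
    and "[\<alpha> = a] (mod 2)"
    and "\<beta> = 2 * \<lfloor>real_of_int (b * (\<alpha> + a)) / real_of_int (2 * a)\<rfloor> - b"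
  shows "real (N0 a b ((b * \<alpha> + a * \<beta>) div 2)) = real_of_int ((\<alpha> + 1) * (\<beta> + 1)) / 2"
proof -
  define k where "k = (b * \<alpha> + a * \<beta>) div 2"
  have k2: "2 * k = a * \<beta> + b * \<alpha>"
    using N0_argument_exact[OF assms(7,8)] unfolding k_def by simp
  obtain p where p: "\<alpha> + a = 2 * p"
    using assms(7) unfolding cong_def by (metis dvdE even_add even_iff_mod_2_eq_zero)
  define q where "q = b * p div a"
  define r where "r = b * p mod a"
  have \<alpha>: "\<alpha> = 2 * p - a"
    using p by simp
  have "b * (\<alpha> + a) div (2 * a) = (2 * (b * p)) div (2 * a)"
    unfolding p by (simp add: algebra_simps)
  then have \<beta>: "\<beta> = 2 * q - b"
    using assms(8) unfolding floor_eq_div q_def by simp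
  have r: "b * p = a * q + r" "0 \<le> r" "r < a"
    using assms(1) unfolding q_def r_def by simp_all
  have k: "k = a * \<beta> + r" "k = b * \<alpha> - r" "k = a * (q - b) + b * p"
    using k2 r(1) unfolding \<alpha> \<beta> by (simp_all add: algebra_simps)
  \<comment> \<open>Equating the two expressions for \<open>k\<close> gives \<open>a * \<beta> + 2 * r = b * \<alpha> > 0\<close>, and \<open>r < a\<close>.\<close>
  have "- 1 \<le> \<beta>"
  proof -
    have "0 < b * \<alpha>"
      using assms(2,5) by simp
    then have "0 < a * \<beta> + 2 * r"
      using k by simp
    then have "0 < a * (\<beta> + 2)"
      using r by (simp add: algebra_simps)
    then show ?thesis
      using assms(1) by (simp add: zero_less_mult_iff)
  qed
  show ?thesis
  proof (cases "\<beta> = - 1")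
    \<comment> \<open>The rectangle is empty and \<open>k = r - a\<close> is negative, so both sides of the formula vanish.\<close>
    case True
    then have "k < 0"
      using k r by simp
    then show ?thesis
      using True unfolding k_def N0_def by simp
  next
    case False
    with \<open>- 1 \<le> \<beta>\<close> have "0 \<le> \<beta>"
      by simp
    then have "0 \<le> k"
      using k(1) r(2) assms(1) by simp
    define T where "T = {(x, y). x \<in> {0..\<beta>} \<and> y \<in> {0..\<alpha>} \<and> a * x + b * y \<le> k}"
    have bounds: "x \<le> \<beta> \<and> y \<le> \<alpha>" if "0 \<le> x" "0 \<le> y" "a * x + b * y \<le> k" for x y
    proof -
      have "0 \<le> a * x" "0 \<le> b * y"
        using that assms(1,2) by simp_all
      then have "a * x < a * (\<beta> + 1)" "b * y \<le> b * \<alpha>"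
        using that(3) k r by (simp_all add: algebra_simps)
      then show ?thesis
        using assms(1,2) by simp
    qed
    have "{n. 0 \<le> n \<and> n \<le> k \<and> (\<exists>x y. 0 \<le> x \<and> 0 \<le> y \<and> n = a * x + b * y)}
        = (\<lambda>(x, y). a * x + b * y) ` T" (is "?S = ?I")
    proof
      show "?S \<subseteq> ?I"
        unfolding T_def using bounds by fastforce
      show "?I \<subseteq> ?S"
        unfolding T_def using assms(1,2) by fastforce
    qed
    moreover have "inj_on (\<lambda>(x, y). a * x + b * y) T"
      by (rule inj_on_subset[OF inj_on_linear_form[OF assms(1,3,6)]]) (auto simp: T_def)
    ultimately have N0: "N0 a b k = card T"
      using \<open>0 \<le> k\<close> unfolding N0_def by (simp add: card_image)
    have off_line: "a * x + b * y \<noteq> k" if "x \<in> {0..\<beta>}" "y \<in> {0..\<alpha>}" for x y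
    proof
      assume "a * x + b * y = k"
      moreover have "\<bar>y - p\<bar> < a"
        using that(2) \<alpha> assms(6) by simp
      ultimately have "y = p"
        using coprime_linear_eq_imp_eq_snd[OF assms(3)] k(3) by metis
      then show False
        using that(2) \<alpha> assms(6) by simp
    qed
    have "2 * card T = card ({0..\<beta>} \<times> {0..\<alpha>})"
      unfolding T_def by (rule card_rectangle_below_central_line[OF k2 off_line])
    also have "\<dots> = nat ((\<alpha> + 1) * (\<beta> + 1))"
      using \<open>0 \<le> \<beta>\<close> assms(5) by (simp add: card_cartesian_product nat_mult_distrib)
    finally have "int (2 * card T) = int (nat ((\<alpha> + 1) * (\<beta> + 1)))"
      by (rule arg_cong)
    then have "2 * int (card T) = (\<alpha> + 1) * (\<beta> + 1)"
      using \<open>0 \<le> \<beta>\<close> assms(5) by (simp del: nat_mult_distrib)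
    then have "2 * real (card T) = real_of_int ((\<alpha> + 1) * (\<beta> + 1))"
      by (metis of_int_mult of_int_numeral of_int_of_nat_eq)
    then show ?thesis
      using N0 unfolding k_def by simp
  qed
qed

end
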